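(* Let $\mathcal{M}_n$ be a family of irreducible and aperiodic Markov chains of problem size $n$, on finite state spaces $\mathcal{X}=\mathcal{X}_n$, where $\mathcal{M}_n$ is obtained by applying the Metropolis algorithm, with target stationary distribution $\pi$, to an irreducible Markov chain on $\mathcal{X}$ with transition matrix $\Psi(\cdot,\cdot)$. Suppose that there exists a function $\Psi(x)$ on $\mathcal{X}$ such that $\Psi(x)=\Psi(y,x)$ for all $x\neq y$, and that $\pi(x)=1/|\mathcal{X}|$ for all $x$. Then $\mathcal{M}_n$ is rapidly mixing if and only if $$\frac{1}{|\mathcal{X}|\min_{x\in\mathcal{X}}\Psi(x)}=\mathsf{poly}(n).$$
   Context: For a Markov chain on $\mathcal{X}$ with transition matrix $P$, $P^t(x,y)$ is the probability of proceeding from $x$ to $y$ in exactly $t$ steps. The chain is irreducible if for every $x,y\in\mathcal{X}$ there is $t\ge 0$ with $P^t(x,y)>0$; it is aperiodic if for every $x\in\mathcal{X}$ the greatest common divisor of $\{t\ge 1:P^t(x,x)>0\}$ is $1$. The Metropolis algorithm takes an irreducible Markov chain with state space $\mathcal{X}$ and transition matrix $\Psi$, together with a distribution $\pi$ on $\mathcal{X}$, and produces the chain with transition matrix $$P(x,y)=\Psi(x,y)\min\Big\{1,\frac{\pi(y)\Psi(y,x)}{\pi(x)\Psi(x,y)}\Big\}\ (y\ne x),\qquad P(x,x)=1-\sum_{z\ne x}\Psi(x,z)\min\Big\{1,\frac{\pi(z)\Psi(z,x)}{\pi(x)\Psi(x,z)}\Big\},$$ which has stationary distribution $\pi$. The one-argument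 function $\Psi(x)$ in the claim is the common value of the off-diagonal entries $\Psi(y,x)$, $y\neq x$; the diagonal entries $\Psi(x,x)$ are not constrained by this condition. For distributions $\mu,\nu$ on $\mathcal{X}$, $d_{\mathsf{TV}}(\mu,\nu)=\max_{A\subseteq\mathcal{X}}|\mu(A)-\nu(A)|$. Put $d(t)=\max_{x\in\mathcal{X}}d_{\mathsf{TV}}(P^t(x,\cdot),\pi)$ and $t_{\mathsf{mix}}(\epsilon)=\min\{t:d(t)\le\epsilon\}$. The family is rapidly mixing if $t_{\mathsf{mix}}(\epsilon)$ is bounded by a polynomial in $\epsilon^{-1}$ and $n$, where $n$ is a parameter measuring the problem size. For $f,g:\mathbb{N}_{>0}\to\mathbb{R}_{>0}$, $f=O(g)$ means that there exist $c,M>0$ with $f(n)\le c\,g(n)$ whenever $n\ge M$; $f=\mathsf{poly}(n)$ means that $f=O(h)$ for some real polynomial $h$.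
   Formalization: Added: |X_n| ≥ 3 for all sufficiently large n. The claim fails for two-state chains with Ψ(x,x)=2^{-(n+1)}, which are nearly periodic and mix slowly though the ratio is at most 1; with one state Ψ(x) is unconstrained. *)

theory Defs
  imports Complex_Main "HOL-Library.Landau_Symbols" "HOL-Computational_Algebra.Polynomial"
begin

text \<open>
  A transition matrix on a finite state space \<open>X\<close> is a function \<open>P :: 'a \<Rightarrow> 'a \<Rightarrow> real\<close>, and a
  distribution is a function \<open>'a \<Rightarrow> real\<close>. Only their values on \<open>X\<close> matter; a family of
  chains whose state spaces vary with \<open>n\<close> is a family of subsets of one type.
\<close>

definition distribution_on :: "'a set \<Rightarrow> ('a \<Rightarrow> real) \<Rightarrow> bool" where
  "distribution_on X \<mu> \<longleftrightarrow> (\<forall>x\<in>X. 0 \<le> \<mu> x) \<and> (\<Sum>x\<in>X. \<mu> x) = 1"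

definition transition_matrix_on :: "'a set \<Rightarrow> ('a \<Rightarrow> 'a \<Rightarrow> real) \<Rightarrow> bool" where
  "transition_matrix_on X P \<longleftrightarrow> (\<forall>x\<in>X. distribution_on X (P x))"

primrec steps :: "'a set \<Rightarrow> ('a \<Rightarrow> 'a \<Rightarrow> real) \<Rightarrow> nat \<Rightarrow> 'a \<Rightarrow> 'a \<Rightarrow> real" where
  "steps X P 0 x y = (if x = y then 1 else 0)"
| "steps X P (Suc t) x y = (\<Sum>z\<in>X. P x z * steps X P t z y)"

definition irreducible_on :: "'a set \<Rightarrow> ('a \<Rightarrow> 'a \<Rightarrow> real) \<Rightarrow> bool" where
  "irreducible_on X P \<longleftrightarrow> (\<forall>x\<in>X. \<forall>y\<in>X. \<exists>t. steps X P t x y > 0)"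

definition aperiodic_on :: "'a set \<Rightarrow> ('a \<Rightarrow> 'a \<Rightarrow> real) \<Rightarrow> bool" where
  "aperiodic_on X P \<longleftrightarrow> (\<forall>x\<in>X. Gcd {t. t \<ge> 1 \<and> steps X P t x x > 0} = 1)"

text \<open>
  If \<open>\<Psi> x y = 0\<close>, the quotient below is a division by zero, but it is multiplied by
  \<open>\<Psi> x y\<close>, so the acceptance term is 0, as intended.
\<close>

definition acceptance :: "('a \<Rightarrow> 'a \<Rightarrow> real) \<Rightarrow> ('a \<Rightarrow> real) \<Rightarrow> 'a \<Rightarrow> 'a \<Rightarrow> real" where
  "acceptance \<Psi> \<pi> x y = min 1 ((\<pi> y * \<Psi> y x) / (\<pi> x * \<Psi> x y))"

definition metropolis ::
  "'a set \<Rightarrow> ('a \<Rightarrow> 'a \<Rightarrow> real) \<Rightarrow> ('a \<Rightarrow> real) \<Rightarrow> 'a \<Rightarrow> 'a \<Rightarrow> real" where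
  "metropolis X \<Psi> \<pi> x y =
     (if y \<noteq> x then \<Psi> x y * acceptance \<Psi> \<pi> x y
      else 1 - (\<Sum>z\<in>X - {x}. \<Psi> x z * acceptance \<Psi> \<pi> x z))"

definition tv_dist :: "'a set \<Rightarrow> ('a \<Rightarrow> real) \<Rightarrow> ('a \<Rightarrow> real) \<Rightarrow> real" where
  "tv_dist X \<mu> \<nu> = (MAX A\<in>Pow X. \<bar>(\<Sum>x\<in>A. \<mu> x) - (\<Sum>x\<in>A. \<nu> x)\<bar>)"

definition worst_dist ::
  "'a set \<Rightarrow> ('a \<Rightarrow> 'a \<Rightarrow> real) \<Rightarrow> ('a \<Rightarrow> real) \<Rightarrow> nat \<Rightarrow> real" where
  "worst_dist X P \<pi> t = (MAX x\<in>X. tv_dist X (steps X P t x) \<pi>)"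

text \<open>
  The minimum exists for every \<open>\<epsilon> > 0\<close> when \<open>P\<close> is irreducible and aperiodic on a finite
  nonempty \<open>X\<close> with stationary distribution \<open>\<pi>\<close>; the constant is only meaningful in that case.
\<close>

definition mixing_time ::
  "'a set \<Rightarrow> ('a \<Rightarrow> 'a \<Rightarrow> real) \<Rightarrow> ('a \<Rightarrow> real) \<Rightarrow> real \<Rightarrow> nat" where
  "mixing_time X P \<pi> \<epsilon> = (LEAST t. worst_dist X P \<pi> t \<le> \<epsilon>)"

text \<open>
  A real polynomial in two variables is an element \<open>p\<close> of \<open>real poly poly\<close>; its value at
  \<open>(a, b)\<close> is \<open>poly (poly p [:a:]) b\<close>.
\<close>

definition rapidly_mixing ::
  "(nat \<Rightarrow> 'a set) \<Rightarrow> (nat \<Rightarrow> 'a \<Rightarrow> 'a \<Rightarrow> real) \<Rightarrow> (nat \<Rightarrow> 'a \<Rightarrow> real) \<Rightarrow> bool" where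
  "rapidly_mixing X P \<pi> \<longleftrightarrow>
     (\<exists>p :: real poly poly. \<forall>n>0. \<forall>\<epsilon>>0.
        real (mixing_time (X n) (P n) (\<pi> n) \<epsilon>) \<le> poly (poly p [:inverse \<epsilon>:]) (real n))"

definition polynomially_bounded :: "(nat \<Rightarrow> real) \<Rightarrow> bool" where
  "polynomially_bounded f \<longleftrightarrow> (\<exists>h :: real poly. f \<in> O(\<lambda>n. poly h (real n)))"

end

theory Submission
  imports Defs
begin

text \<open>
  Off the diagonal the Metropolis chain is \<open>P x y = min (\<psi> x) (\<psi> y)\<close>, hence symmetric.
  Put \<open>N = card X\<close> and \<open>m = min \<psi>\<close>. Two rows \<open>P x\<close>, \<open>P y\<close> both have mass at least \<open>m\<close> at each of
  the other \<open>N - 2\<close> points, so for \<open>N \<ge> 3\<close> Dobrushin's coefficient is at most \<open>1 - N * m / 3\<close>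
  and the distance to stationarity decays like \<open>(1 - N * m / 3) ^ t\<close>. Conversely, the chain
  leaves a minimiser of \<open>\<psi>\<close> with probability only \<open>(N - 1) * m\<close> per step, which bounds the mixing
  time from below by a multiple of \<open>1 / (N * m)\<close>. The finitely many \<open>n\<close> with \<open>N \<le> 2\<close> only affect
  the constants; there aperiodicity is what excludes \<open>m = 1\<close>.
\<close>

section \<open>Contraction of oscillation\<close>

lemma transition_matrix_onD:
  assumes "transition_matrix_on X P" "x \<in> X"
  shows "\<And>y. y \<in> X \<Longrightarrow> 0 \<le> P x y" "(\<Sum>y\<in>X. P x y) = 1"
  using assms by (auto simp: transition_matrix_on_def distribution_on_def)

text \<open>Dobrushin's argument: the common part \<open>r\<close> of the two rows cancels in the
  difference, and both remainders have the same mass. On \<open>X\<close> the function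
  \<open>f\<close> stays between its minimum \<open>a\<close> and \<open>a + D\<close>.\<close>

lemma oscillation_contraction:
  fixes f :: "'a \<Rightarrow> real"
  assumes X: "finite X" and P: "transition_matrix_on X P"
    and xy: "x \<in> X" "y \<in> X"
    and overlap: "\<delta> \<le> (\<Sum>z\<in>X. min (P x z) (P y z))"
    and osc: "\<And>u v. u \<in> X \<Longrightarrow> v \<in> X \<Longrightarrow> f u - f v \<le> D"
  shows "(\<Sum>z\<in>X. P x z * f z) - (\<Sum>z\<in>X. P y z * f z) \<le> (1 - \<delta>) * D"
proof -
  define r where "r z = min (P x z) (P y z)" for z
  define a where "a = Min (f ` X)"
  have "a \<in> f ` X"
    unfolding a_def using X xy by (intro Min_in) auto
  then obtain u where u: "u \<in> X" "a = f u" by auto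
  have low: "a \<le> f z" if "z \<in> X" for z
    unfolding a_def using X that by (intro Min_le) auto
  have D: "0 \<le> D" using osc[OF u(1) u(1)] by simp
  have sums: "(\<Sum>z\<in>X. P x z) = 1" "(\<Sum>z\<in>X. P y z) = 1"
    using transition_matrix_onD(2)[OF P] xy by auto
  have "(\<Sum>z\<in>X. P x z * f z) - (\<Sum>z\<in>X. P y z * f z)
      = (\<Sum>z\<in>X. (P x z - r z) * f z) - (\<Sum>z\<in>X. (P y z - r z) * f z)"
    by (simp add: algebra_simps sum_subtractf)
  also have "\<dots> \<le> (\<Sum>z\<in>X. (P x z - r z) * (a + D)) - (\<Sum>z\<in>X. (P y z - r z) * a)"
  proof (intro diff_mono sum_mono mult_left_mono)
    show "f z \<le> a + D" if "z \<in> X" for z using osc[OF that u(1)] u(2) by simp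
  qed (auto simp: r_def low)
  also have "\<dots> = (1 - (\<Sum>z\<in>X. r z)) * D"
    unfolding sum_distrib_right[symmetric] sum_subtractf sums by (simp add: algebra_simps)
  also have "\<dots> \<le> (1 - \<delta>) * D"
    using overlap D by (intro mult_right_mono) (auto simp: r_def)
  finally show ?thesis .
qed

text \<open>The probability of ending in \<open>A\<close>, as a function of the start, evolves by
  applying \<open>P\<close>, which is the shape that \<open>oscillation_contraction\<close>
  takes.\<close>

lemma sum_steps_Suc:
  "(\<Sum>y\<in>A. steps X P (Suc t) x y) = (\<Sum>z\<in>X. P x z * (\<Sum>y\<in>A. steps X P t z y))"
  by (simp add: sum_distrib_left) (rule sum.swap)

text \<open>Iterates the contraction, starting from the indicator of \<open>A\<close>, whose
  oscillation is at most 1.\<close>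

lemma steps_oscillation_le:
  assumes X: "finite X" and P: "transition_matrix_on X P"
    and overlap: "\<And>x y. x \<in> X \<Longrightarrow> y \<in> X \<Longrightarrow> \<delta> \<le> (\<Sum>z\<in>X. min (P x z) (P y z))"
    and A: "A \<subseteq> X" and xy: "x \<in> X" "y \<in> X"
  shows "(\<Sum>z\<in>A. steps X P t x z) - (\<Sum>z\<in>A. steps X P t y z) \<le> (1 - \<delta>) ^ t"
  using xy
proof (induction t arbitrary: x y)
  case 0
  then show ?case using finite_subset[OF A X] by simp
next
  case (Suc t)
  show ?case
    unfolding sum_steps_Suc power_Suc
    using Suc by (intro oscillation_contraction X P overlap)
qed

section \<open>Sign, column sums, return probabilities and reachability\<close>

lemma steps_nonneg:
  assumes "transition_matrix_on X P" "x \<in> X"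
  shows "0 \<le> steps X P t x y"
  using assms(2)
  by (induction t arbitrary: x) (auto intro!: sum_nonneg mult_nonneg_nonneg transition_matrix_onD[OF assms(1)])

text \<open>Unit column sums make the counting measure invariant; in this form stationarity of the
  uniform distribution enters.\<close>

lemma steps_column_sum:
  assumes "finite X" "\<And>y. y \<in> X \<Longrightarrow> (\<Sum>x\<in>X. P x y) = 1" "y \<in> X"
  shows "(\<Sum>x\<in>X. steps X P t x y) = 1"
proof (induction t)
  case (Suc t)
  have "(\<Sum>x\<in>X. steps X P (Suc t) x y) = (\<Sum>z\<in>X. (\<Sum>x\<in>X. P x z) * steps X P t z y)"
    by (simp add: sum_distrib_right) (rule sum.swap)
  then show ?case using assms Suc by simp
qed (use assms in simp)

lemma steps_diagonal_ge:
  assumes "finite X" "transition_matrix_on X P" "x \<in> X"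
  shows "P x x ^ t \<le> steps X P t x x"
proof (induction t)
  case (Suc t)
  note D = transition_matrix_onD(1)[OF assms(2,3)]
  have "P x x ^ Suc t \<le> P x x * steps X P t x x"
    using Suc D assms(3) by (simp add: mult_left_mono)
  also have "\<dots> \<le> (\<Sum>z\<in>X. P x z * steps X P t z x)"
    using assms by (intro member_le_sum) (auto intro!: mult_nonneg_nonneg D steps_nonneg)
  finally show ?case by simp
qed simp

text \<open>If no other state moved to \<open>x\<close> in one step, none would ever reach it, yet
  \<open>y\<close> must.\<close>

lemma irreducible_on_enterable:
  assumes "irreducible_on X P" "x \<in> X" "y \<in> X" "y \<noteq> x"
  shows "\<exists>z\<in>X. z \<noteq> x \<and> P z x \<noteq> 0"
proof (rule ccontr)
  assume none: "\<not> ?thesis"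
  have "steps X P t z x = 0" if "z \<in> X" "z \<noteq> x" for t z
    using that
  proof (induction t arbitrary: z)
    case (Suc t)
    have "P z w * steps X P t w x = 0" if "w \<in> X" for w
      using none Suc that by (cases "w = x") auto
    then show ?case unfolding steps.simps by (intro sum.neutral) blast
  qed simp
  with assms show False unfolding irreducible_on_def by (metis less_irrefl)
qed

section \<open>Distance to the uniform distribution\<close>

lemma tv_dist_ge:
  assumes "finite X" "A \<subseteq> X"
  shows "\<bar>(\<Sum>x\<in>A. \<mu> x) - (\<Sum>x\<in>A. \<nu> x)\<bar> \<le> tv_dist X \<mu> \<nu>"
  unfolding tv_dist_def using assms by (intro Max_ge) auto

lemma worst_dist_ge:
  assumes "finite X" "x \<in> X"
  shows "tv_dist X (steps X P t x) \<pi> \<le> worst_dist X P \<pi> t"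
  unfolding worst_dist_def using assms by (intro Max_ge) auto

text \<open>By the unit column sums, the \<pi>-mass of \<open>A\<close> is the average of
  \<open>F y\<close> over \<open>X\<close>, so its distance from \<open>F x\<close> is at most the
  oscillation of \<open>F\<close>.\<close>

lemma worst_dist_le:
  assumes X: "finite X" "X \<noteq> {}" and P: "transition_matrix_on X P"
    and cols: "\<And>y. y \<in> X \<Longrightarrow> (\<Sum>x\<in>X. P x y) = 1"
    and uniform: "\<And>x. x \<in> X \<Longrightarrow> \<pi> x = 1 / real (card X)"
    and overlap: "\<And>x y. x \<in> X \<Longrightarrow> y \<in> X \<Longrightarrow> \<delta> \<le> (\<Sum>z\<in>X. min (P x z) (P y z))"
  shows "worst_dist X P \<pi> t \<le> (1 - \<delta>) ^ t"
proof -
  have N: "real (card X) > 0" using X by (simp add: card_gt_0_iff)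
  have "\<bar>(\<Sum>z\<in>A. steps X P t x z) - (\<Sum>z\<in>A. \<pi> z)\<bar> \<le> (1 - \<delta>) ^ t"
    if x: "x \<in> X" and A: "A \<subseteq> X" for x A
  proof -
    define F where "F y = (\<Sum>z\<in>A. steps X P t y z)" for y
    have "(\<Sum>y\<in>X. F y) = (\<Sum>z\<in>A. \<Sum>y\<in>X. steps X P t y z)"
      unfolding F_def by (rule sum.swap)
    also have "\<dots> = (\<Sum>z\<in>A. 1)"
      using A by (intro sum.cong steps_column_sum X cols) auto
    also have "\<dots> = real (card X) * (\<Sum>z\<in>A. 1 / real (card X))"
      using N by simp
    also have "(\<Sum>z\<in>A. 1 / real (card X)) = (\<Sum>z\<in>A. \<pi> z)"
      using A by (intro sum.cong) (auto simp: uniform)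
    finally have mean: "(\<Sum>y\<in>X. F y) = real (card X) * (\<Sum>z\<in>A. \<pi> z)" .
    have osc: "F y - F y' \<le> (1 - \<delta>) ^ t" if "y \<in> X" "y' \<in> X" for y y'
      unfolding F_def by (rule steps_oscillation_le[OF X(1) P overlap A that])
    have "(\<Sum>y\<in>X. F x - F y) \<le> real (card X) * (1 - \<delta>) ^ t"
      and "(\<Sum>y\<in>X. F y - F x) \<le> real (card X) * (1 - \<delta>) ^ t"
      using osc x by (auto intro!: sum_bounded_above)
    then have "real (card X) * (F x - (\<Sum>z\<in>A. \<pi> z)) \<le> real (card X) * (1 - \<delta>) ^ t"
      and "real (card X) * ((\<Sum>z\<in>A. \<pi> z) - F x) \<le> real (card X) * (1 - \<delta>) ^ t"
      by (auto simp: sum_subtractf mean algebra_simps)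
    then show ?thesis
      using N unfolding F_def by (simp add: mult_le_cancel_left_pos abs_le_iff)
  qed
  then have "tv_dist X (steps X P t x) \<pi> \<le> (1 - \<delta>) ^ t" if "x \<in> X" for x
    unfolding tv_dist_def using X that by (intro Max.boundedI) auto
  then show ?thesis
    unfolding worst_dist_def using X by (intro Max.boundedI) auto
qed

text \<open>Multiplying by \<open>1 + real t * \<delta> \<le> (1 + \<delta>) ^ t\<close> leaves a
  power of \<open>1 - \<delta>\<^sup>2\<close>. Decay of order 1/t suffices for a bound polynomial
  in \<open>inverse \<epsilon>\<close> and avoids logarithms.\<close>

lemma power_one_minus_le:
  fixes \<delta> :: real
  assumes "0 < \<delta>" "\<delta> \<le> 1"
  shows "(1 - \<delta>) ^ t \<le> 1 / (1 + real t * \<delta>)"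
proof -
  have "(1 - \<delta>) ^ t * (1 + real t * \<delta>) \<le> (1 - \<delta>) ^ t * (1 + \<delta>) ^ t"
    using assms by (intro mult_left_mono Bernoulli_inequality) auto
  also have "\<dots> = (1 - \<delta>\<^sup>2) ^ t"
    by (simp flip: power_mult_distrib add: power2_eq_square algebra_simps)
  also have "\<dots> \<le> 1"
    using assms by (intro power_le_one) (auto simp: power_le_one)
  finally show ?thesis
    using assms by (simp add: pos_le_divide_eq add_pos_nonneg)
qed

lemma mixing_time_geometric:
  assumes decay: "\<And>t. worst_dist X P \<pi> t \<le> (1 - \<delta>) ^ t"
    and \<delta>: "0 < \<delta>" "\<delta> \<le> 1" and \<epsilon>: "0 < \<epsilon>"
  shows "worst_dist X P \<pi> (mixing_time X P \<pi> \<epsilon>) \<le> \<epsilon>"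
    and "real (mixing_time X P \<pi> \<epsilon>) \<le> 1 + 1 / \<delta> * inverse \<epsilon>"
proof -
  \<comment> \<open>Then \<open>real t * \<delta>\<close> is at least \<open>1 / \<epsilon>\<close>.
    This time also witnesses that the \<open>LEAST\<close> in \<open>mixing_time\<close> is
    attained.\<close>
  define t where "t = nat \<lceil>1 / (\<delta> * \<epsilon>)\<rceil>"
  have t: "1 / (\<delta> * \<epsilon>) \<le> real t" "real t \<le> 1 + 1 / (\<delta> * \<epsilon>)"
    using \<delta> \<epsilon> unfolding t_def by (simp_all add: real_nat_ceiling_ge add.commute[of 1])
  have "1 \<le> real t * \<delta> * \<epsilon>"
    using t(1) \<delta> \<epsilon> by (simp add: field_simps)
  then have "1 \<le> \<epsilon> * (1 + real t * \<delta>)"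
    using \<epsilon> by (simp add: algebra_simps)
  then have "1 / (1 + real t * \<delta>) \<le> \<epsilon>"
    using \<delta> by (simp add: pos_divide_le_eq add_pos_nonneg)
  then have good: "worst_dist X P \<pi> t \<le> \<epsilon>"
    using decay[of t] power_one_minus_le[OF \<delta>, of t] by linarith
  show "worst_dist X P \<pi> (mixing_time X P \<pi> \<epsilon>) \<le> \<epsilon>"
    unfolding mixing_time_def by (rule LeastI[of _ t], rule good)
  have "mixing_time X P \<pi> \<epsilon> \<le> t"
    unfolding mixing_time_def by (rule Least_le, rule good)
  then show "real (mixing_time X P \<pi> \<epsilon>) \<le> 1 + 1 / \<delta> * inverse \<epsilon>"
    using t(2) by (simp add: field_simps)
qed

section \<open>The Metropolis chain with uniform target\<close>

text \<open>One chain of the family, at a fixed problem size. Only pairs of distinct points tie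
  \<psi> to \<Psi>, so on a one-point space \<psi> is arbitrary.\<close>

locale uniform_metropolis =
  fixes X :: "'a set" and \<Psi> P :: "'a \<Rightarrow> 'a \<Rightarrow> real" and \<pi> \<psi> :: "'a \<Rightarrow> real"
  assumes finite_X: "finite X" and nonempty_X: "X \<noteq> {}"
    and base_stochastic: "transition_matrix_on X \<Psi>"
    and base_irreducible: "irreducible_on X \<Psi>"
    and chain: "\<And>x y. x \<in> X \<Longrightarrow> y \<in> X \<Longrightarrow> P x y = metropolis X \<Psi> \<pi> x y"
    and chain_aperiodic: "aperiodic_on X P"
    and off_diagonal: "\<And>x y. x \<in> X \<Longrightarrow> y \<in> X \<Longrightarrow> x \<noteq> y \<Longrightarrow> \<psi> x = \<Psi> y x"
    and uniform: "\<And>x. x \<in> X \<Longrightarrow> \<pi> x = 1 / real (card X)"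
begin

section \<open>The minimum of \<psi> and the entries of the chain\<close>

definition m :: real where "m = (MIN x\<in>X. \<psi> x)"

lemma m_le: "x \<in> X \<Longrightarrow> m \<le> \<psi> x"
  unfolding m_def using finite_X by (intro Min_le) auto

lemma m_attained: "\<exists>x\<in>X. \<psi> x = m"
proof -
  have "m \<in> \<psi> ` X"
    unfolding m_def using finite_X nonempty_X by (intro Min_in) auto
  then show ?thesis by auto
qed

lemma card_X_pos: "0 < card X"
  using finite_X nonempty_X by (simp add: card_gt_0_iff)

text \<open>By irreducibility some other state \<open>z\<close> enters \<open>x\<close> with
  positive probability, and that entry of \<Psi> is \<open>\<psi> x\<close>.\<close>

lemma psi_pos:
  assumes "card X \<ge> 2" "x \<in> X"
  shows "0 < \<psi> x"
proof -
  have "X \<noteq> {x}" using assms by auto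
  then obtain y where "y \<in> X" "y \<noteq> x" using assms(2) by auto
  then obtain z where z: "z \<in> X" "z \<noteq> x" "\<Psi> z x \<noteq> 0"
    using irreducible_on_enterable[OF base_irreducible assms(2)] by blast
  then show ?thesis
    using transition_matrix_onD(1)[OF base_stochastic z(1) assms(2)] off_diagonal[OF assms(2) z(1)]
    by auto
qed

lemma m_pos: "card X \<ge> 2 \<Longrightarrow> 0 < m"
  using m_attained psi_pos by force

lemma psi_pos':
  assumes "x \<in> X" "y \<in> X" "x \<noteq> y"
  shows "0 < \<psi> x"
proof (rule psi_pos)
  have "card {x, y} \<le> card X" using assms finite_X by (intro card_mono) auto
  then show "2 \<le> card X" using assms by simp
qed fact

text \<open>The uniform weights cancel in the acceptance ratio, leaving
  \<open>\<psi> y * min 1 (\<psi> x / \<psi> y)\<close>.\<close>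

lemma P_off_diagonal:
  assumes "x \<in> X" "y \<in> X" "x \<noteq> y"
  shows "P x y = min (\<psi> x) (\<psi> y)"
proof -
  have "0 < \<psi> y" "0 < \<psi> x" using assms psi_pos' by auto
  then show ?thesis
    using assms off_diagonal[of x y] off_diagonal[of y x] card_X_pos
    by (auto simp: chain metropolis_def acceptance_def uniform min_def field_simps)
qed

lemma P_diagonal:
  assumes "x \<in> X"
  shows "P x x = 1 - (\<Sum>z\<in>X - {x}. P x z)"
proof -
  have "(\<Sum>z\<in>X - {x}. P x z) = (\<Sum>z\<in>X - {x}. \<Psi> x z * acceptance \<Psi> \<pi> x z)"
    using assms by (intro sum.cong) (auto simp: chain metropolis_def)
  then show ?thesis using assms by (simp add: chain metropolis_def)
qed

lemma P_sym: "x \<in> X \<Longrightarrow> y \<in> X \<Longrightarrow> P x y = P y x"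
  by (cases "x = y") (auto simp: P_off_diagonal)

lemma P_row: "x \<in> X \<Longrightarrow> (\<Sum>y\<in>X. P x y) = 1"
  using finite_X by (simp add: P_diagonal sum.remove)

lemma P_column: "y \<in> X \<Longrightarrow> (\<Sum>x\<in>X. P x y) = 1"
  using P_row[of y] P_sym[of _ y] by simp

lemma P_nonneg:
  assumes "x \<in> X" "y \<in> X"
  shows "0 \<le> P x y"
proof (cases "x = y")
  case True
  \<comment> \<open>Rejection only lowers off-diagonal entries:
    \<open>min (\<psi> x) (\<psi> z)\<close> is at most \<open>\<psi> z\<close>, which is
    \<open>\<Psi> x z\<close>.\<close>
  have "(\<Sum>z\<in>X - {x}. P x z) \<le> (\<Sum>z\<in>X - {x}. \<Psi> x z)"
    using assms off_diagonal by (intro sum_mono) (auto simp: P_off_diagonal min_le_iff_disj)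
  also have "\<dots> \<le> (\<Sum>z\<in>X. \<Psi> x z)"
    using assms finite_X transition_matrix_onD(1)[OF base_stochastic] by (intro sum_mono2) auto
  also have "\<dots> = 1"
    by (rule transition_matrix_onD(2)[OF base_stochastic assms(1)])
  finally show ?thesis using assms True by (simp add: P_diagonal)
next
  case False
  then show ?thesis
    using assms psi_pos'[of x y] psi_pos'[of y x] by (simp add: P_off_diagonal)
qed

lemma P_stochastic: "transition_matrix_on X P"
  by (auto simp: transition_matrix_on_def distribution_on_def P_nonneg P_row)

lemma P_minimiser:
  assumes "x \<in> X" "\<psi> x = m"
  shows "P x x = 1 - real (card X - 1) * m"
proof -
  have "(\<Sum>z\<in>X - {x}. P x z) = (\<Sum>z\<in>X - {x}. m)"
    using assms m_le by (intro sum.cong) (auto simp: P_off_diagonal min_def)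
  then show ?thesis using assms finite_X by (simp add: P_diagonal)
qed

section \<open>Overlap of two rows and the decay rate\<close>

lemma m_le_P: "x \<in> X \<Longrightarrow> y \<in> X \<Longrightarrow> x \<noteq> y \<Longrightarrow> m \<le> P x y"
  using m_le by (simp add: P_off_diagonal)

text \<open>Off \<open>{x, y}\<close> both rows are at least \<open>m\<close>; the factor 1/3 comes
  from \<open>N \<le> 3 * (N - 2)\<close> for \<open>N \<ge> 3\<close>.\<close>

lemma overlap_ge:
  assumes "3 \<le> card X" and xy: "x \<in> X" "y \<in> X"
  shows "real (card X) * m / 3 \<le> (\<Sum>z\<in>X. min (P x z) (P y z))"
proof -
  have m: "0 < m" using m_pos assms by simp
  \<comment> \<open>Only an inequality, since \<open>{x, y}\<close> is a singleton when
    \<open>x = y\<close>.\<close>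
  have "card X \<le> card (X - {x, y}) + 2"
    using finite_X xy by (simp add: card_Diff_subset) (cases "x = y"; simp)
  then have "real (card X) \<le> 3 * real (card (X - {x, y}))"
    using assms(1) by linarith
  then have "real (card X) * m / 3 \<le> real (card (X - {x, y})) * m"
    using mult_right_mono[of "real (card X)" "3 * real (card (X - {x, y}))" m] m by simp
  also have "\<dots> = (\<Sum>z\<in>X - {x, y}. m)" by simp
  also have "\<dots> \<le> (\<Sum>z\<in>X - {x, y}. min (P x z) (P y z))"
    using xy by (intro sum_mono) (auto intro: m_le_P)
  also have "\<dots> \<le> (\<Sum>z\<in>X. min (P x z) (P y z))"
    using finite_X xy P_nonneg by (intro sum_mono2) auto
  finally show ?thesis .
qed

lemma overlap_self: "x \<in> X \<Longrightarrow> (\<Sum>z\<in>X. min (P x z) (P x z)) = 1"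
  by (simp add: P_row)

text \<open>If \<open>P a a\<close> vanishes, unit rows and symmetry make \<open>P b b\<close>
  vanish too; the chain then alternates and returns to \<open>a\<close> at even times only, against
  aperiodicity.\<close>

lemma diagonal_pos_of_card_2:
  assumes X: "X = {a, b}" and ab: "a \<noteq> b"
  shows "0 < P a a"
proof (rule ccontr)
  assume "\<not> 0 < P a a"
  then have aa: "P a a = 0" using P_nonneg[of a a] X by simp
  have "P a a + P a b = 1" "P b a + P b b = 1"
    using P_row[of a] P_row[of b] X ab by auto
  then have bb: "P b b = 0" using aa P_sym[of a b] X by simp
  have parity: "(odd t \<longrightarrow> steps X P t a a = 0) \<and> (even t \<longrightarrow> steps X P t b a = 0)" for t
    by (induction t) (use aa bb ab in \<open>auto simp: X\<close>)
  have "2 dvd Gcd {t. t \<ge> 1 \<and> steps X P t a a > 0}"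
    using parity by (intro Gcd_greatest) force
  moreover have "Gcd {t. t \<ge> 1 \<and> steps X P t a a > 0} = 1"
    using chain_aperiodic X by (simp add: aperiodic_on_def)
  ultimately show False by simp
qed

lemma overlap_pos:
  assumes xy: "x \<in> X" "y \<in> X"
  shows "0 < (\<Sum>z\<in>X. min (P x z) (P y z))"
proof (cases "x = y")
  case True
  then show ?thesis using overlap_self[OF xy(1)] by simp
next
  case False
  have "card {x, y} \<le> card X" using xy finite_X by (intro card_mono) auto
  then have ge2: "2 \<le> card X" using False by simp
  show ?thesis
  proof (cases "card X = 2")
    case True
    then have X: "X = {x, y}"
      using xy False finite_X card_seteq[of X "{x, y}"] by auto
    have "0 < P x x" "0 < P y y"
      using diagonal_pos_of_card_2[of x y] diagonal_pos_of_card_2[of y x] X False by auto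
    moreover have "0 < P x y" "0 < P y x"
      using m_le_P[of x y] m_le_P[of y x] m_pos[OF ge2] xy False by auto
    ultimately show ?thesis using False by (simp add: X)
  next
    case False
    then have 3: "3 \<le> card X" using ge2 by simp
    then have "0 < real (card X) * m / 3" using m_pos[OF ge2] by simp
    with overlap_ge[OF 3 xy] show ?thesis by linarith
  qed
qed

lemma decay:
  assumes "\<And>x y. x \<in> X \<Longrightarrow> y \<in> X \<Longrightarrow> \<delta> \<le> (\<Sum>z\<in>X. min (P x z) (P y z))"
  shows "worst_dist X P \<pi> t \<le> (1 - \<delta>) ^ t" "\<delta> \<le> 1"
proof -
  show "worst_dist X P \<pi> t \<le> (1 - \<delta>) ^ t"
    by (intro worst_dist_le finite_X nonempty_X P_stochastic P_column uniform assms)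
  show "\<delta> \<le> 1"
    using assms overlap_self nonempty_X by force
qed

text \<open>The least overlap over the finitely many pairs is positive. This rate has no explicit
  size; it guarantees that mixing times are attained and handles the small problem sizes.\<close>

lemma decay_rate_exists:
  obtains \<delta> where "0 < \<delta>" "\<delta> \<le> 1" "\<And>t. worst_dist X P \<pi> t \<le> (1 - \<delta>) ^ t"
proof -
  define \<delta> where "\<delta> = (MIN p\<in>X \<times> X. \<Sum>z\<in>X. min (P (fst p) z) (P (snd p) z))"
  have le: "\<delta> \<le> (\<Sum>z\<in>X. min (P x z) (P y z))" if "x \<in> X" "y \<in> X" for x y
    unfolding \<delta>_def using finite_X that by (intro Min_le) (auto intro!: image_eqI[of _ _ "(x, y)"])
  have "0 < \<delta>"
    unfolding \<delta>_def using finite_X nonempty_X overlap_pos by (subst Min_gr_iff) auto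
  then show ?thesis by (rule that[OF _ decay(2)[OF le] decay(1)[OF le]])
qed

section \<open>Bounds on the mixing time from above and below\<close>

lemma mixing_time_le:
  assumes "3 \<le> card X" "0 < \<epsilon>"
  shows "real (mixing_time X P \<pi> \<epsilon>) \<le> 1 + 3 / (real (card X) * m) * inverse \<epsilon>"
proof -
  have "0 < real (card X) * m / 3" using m_pos assms by simp
  then show ?thesis
    using mixing_time_geometric(2)[of X P \<pi> "real (card X) * m / 3" \<epsilon>]
      decay[OF overlap_ge[OF assms(1)]] assms by simp
qed

text \<open>The test set is a single minimiser of \<psi>: the chain is still there with probability
  at least \<open>P x x ^ t\<close>, while \<pi> gives it only 1/N.\<close>

lemma worst_dist_lower:
  "1 - real t * (real (card X - 1) * m) - 1 / real (card X) \<le> worst_dist X P \<pi> t"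
proof -
  obtain x where x: "x \<in> X" "\<psi> x = m" using m_attained by blast
  have "1 + real t * (- (real (card X - 1) * m)) \<le> (1 + - (real (card X - 1) * m)) ^ t"
    \<comment> \<open>Bernoulli's inequality needs \<open>real (card X - 1) * m \<le> 1\<close>,
      that is, \<open>0 \<le> P x x\<close>.\<close>
    using P_nonneg[OF x(1) x(1)] P_minimiser[OF x] by (intro Bernoulli_inequality) simp
  also have "\<dots> \<le> steps X P t x x"
    using steps_diagonal_ge[OF finite_X P_stochastic x(1), of t] P_minimiser[OF x] by simp
  finally have "1 - real t * (real (card X - 1) * m) - 1 / real (card X) \<le> steps X P t x x - \<pi> x"
    using x by (simp add: uniform)
  also have "\<dots> \<le> tv_dist X (steps X P t x) \<pi>"
    using tv_dist_ge[OF finite_X, of "{x}" "steps X P t x" \<pi>] x by simp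
  also have "\<dots> \<le> worst_dist X P \<pi> t"
    by (rule worst_dist_ge[OF finite_X x(1)])
  finally show ?thesis .
qed

lemma mixing_time_ge:
  assumes "3 \<le> card X"
  shows "1 / (real (card X) * m) \<le> 12 / 5 * real (mixing_time X P \<pi> (1 / 4))"
proof -
  define t where "t = mixing_time X P \<pi> (1 / 4)"
  have m: "0 < m" using m_pos assms by simp
  obtain \<delta> where \<delta>: "0 < \<delta>" "\<delta> \<le> 1" "\<And>t. worst_dist X P \<pi> t \<le> (1 - \<delta>) ^ t"
    by (rule decay_rate_exists) blast
  have "worst_dist X P \<pi> t \<le> 1 / 4"
    unfolding t_def by (rule mixing_time_geometric(1)[OF \<delta>(3,1,2)]) simp
  moreover have "1 / real (card X) \<le> 1 / 3"
    using assms by (intro divide_left_mono) auto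
  \<comment> \<open>\<open>5 / 12 = 1 - 1 / 3 - 1 / 4\<close>.\<close>
  ultimately have "5 / 12 \<le> real t * (real (card X - 1) * m)"
    using worst_dist_lower[of t] by linarith
  also have "\<dots> \<le> real t * (real (card X) * m)"
    using m by (intro mult_left_mono mult_right_mono) auto
  finally show ?thesis
    unfolding t_def[symmetric] using m card_X_pos by (simp add: field_simps)
qed

end

section \<open>Families of chains\<close>

text \<open>On two points the chain swaps with probability \<open>m\<close>; as \<open>m\<close>
  tends to 1 it is nearly periodic and can mix arbitrarily slowly while \<open>1 / (2 * m)\<close>
  stays bounded. On one point \<psi> is arbitrary. \<open>card_X\<close> excludes both for large
  \<open>n\<close>.\<close>

theorem corollary5p2:
  fixes X :: "nat \<Rightarrow> 'a set"
    and \<Psi> P :: "nat \<Rightarrow> 'a \<Rightarrow> 'a \<Rightarrow> real"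
    and \<pi> \<psi> :: "nat \<Rightarrow> 'a \<Rightarrow> real"
  assumes finite_X: "\<And>n. n > 0 \<Longrightarrow> finite (X n)"
    and nonempty_X: "\<And>n. n > 0 \<Longrightarrow> X n \<noteq> {}"
    and card_X: "\<forall>\<^sub>F n in sequentially. 3 \<le> card (X n)"
    and base_stochastic: "\<And>n. n > 0 \<Longrightarrow> transition_matrix_on (X n) (\<Psi> n)"
    and base_irreducible: "\<And>n. n > 0 \<Longrightarrow> irreducible_on (X n) (\<Psi> n)"
    and target: "\<And>n. n > 0 \<Longrightarrow> distribution_on (X n) (\<pi> n)"
    and chain: "\<And>n x y. n > 0 \<Longrightarrow> x \<in> X n \<Longrightarrow> y \<in> X n \<Longrightarrow>
                  P n x y = metropolis (X n) (\<Psi> n) (\<pi> n) x y"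
    and chain_irreducible: "\<And>n. n > 0 \<Longrightarrow> irreducible_on (X n) (P n)"
    and chain_aperiodic: "\<And>n. n > 0 \<Longrightarrow> aperiodic_on (X n) (P n)"
    and off_diagonal: "\<And>n x y. n > 0 \<Longrightarrow> x \<in> X n \<Longrightarrow> y \<in> X n \<Longrightarrow> x \<noteq> y \<Longrightarrow>
                         \<psi> n x = \<Psi> n y x"
    and uniform: "\<And>n x. n > 0 \<Longrightarrow> x \<in> X n \<Longrightarrow> \<pi> n x = 1 / real (card (X n))"
  shows "rapidly_mixing X P \<pi> \<longleftrightarrow>
         polynomially_bounded (\<lambda>n. 1 / (real (card (X n)) * (MIN x\<in>X n. \<psi> n x)))"
proof
  have chains: "uniform_metropolis (X n) (\<Psi> n) (P n) (\<pi> n) (\<psi> n)" if "n > 0" for n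
    by (intro uniform_metropolis.intro finite_X nonempty_X base_stochastic base_irreducible
        chain chain_aperiodic off_diagonal uniform) (assumption | rule that)+
  note m_def = uniform_metropolis.m_def[OF chains]
  obtain N0 where N0: "\<And>n. n \<ge> N0 \<Longrightarrow> 3 \<le> card (X n)"
    using card_X by (auto simp: eventually_sequentially)
  define f where "f n = 1 / (real (card (X n)) * (MIN x\<in>X n. \<psi> n x))" for n

  {
    assume "rapidly_mixing X P \<pi>"
    then obtain p :: "real poly poly" where
      p: "\<And>n \<epsilon>. n > 0 \<Longrightarrow> \<epsilon> > 0 \<Longrightarrow>
        real (mixing_time (X n) (P n) (\<pi> n) \<epsilon>) \<le> poly (poly p [:inverse \<epsilon>:]) (real n)"
      unfolding rapidly_mixing_def by blast
    \<comment> \<open>Fixing \<open>\<epsilon> = 1 / 4\<close> turns the bivariate bound into a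
      polynomial in \<open>n\<close> alone; \<open>[:4:]\<close> holds
      \<open>inverse \<epsilon>\<close>.\<close>
    have "norm (f n) \<le> 12 / 5 * norm (poly (poly p [:4:]) (real n))" if n: "n \<ge> max 1 N0" for n
    proof -
      have n0: "n > 0" and c3: "3 \<le> card (X n)" using n N0 by auto
      have "0 \<le> f n"
        using uniform_metropolis.m_pos[OF chains[OF n0]] c3 by (simp add: f_def m_def[OF n0])
      moreover have "f n \<le> 12 / 5 * real (mixing_time (X n) (P n) (\<pi> n) (1 / 4))"
        using uniform_metropolis.mixing_time_ge[OF chains[OF n0] c3] by (simp add: f_def m_def[OF n0])
      ultimately show ?thesis using p[OF n0, of "1 / 4"] by simp
    qed
    then have "f \<in> O(\<lambda>n. poly (poly p [:4:]) (real n))"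
      by (intro bigoI[of _ "12 / 5"] eventually_sequentiallyI[of "max 1 N0"])
    then show "polynomially_bounded (\<lambda>n. 1 / (real (card (X n)) * (MIN x\<in>X n. \<psi> n x)))"
      unfolding polynomially_bounded_def f_def by blast
  }

  {
    assume "polynomially_bounded (\<lambda>n. 1 / (real (card (X n)) * (MIN x\<in>X n. \<psi> n x)))"
    then obtain h :: "real poly" where "f \<in> O(\<lambda>n. poly h (real n))"
      unfolding polynomially_bounded_def f_def by blast
    then obtain c where c: "c > 0" and "\<forall>\<^sub>F n in sequentially. norm (f n) \<le> c * norm (poly h (real n))"
      by (rule landau_o.bigE)
    then obtain N1 where N1: "\<And>n. n \<ge> N1 \<Longrightarrow> \<bar>f n\<bar> \<le> c * \<bar>poly h (real n)\<bar>"
      by (auto simp: eventually_sequentially)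
    define N where "N = max N0 N1"
    \<comment> \<open>A constant for each \<open>n\<close> separately, to be summed over
      \<open>n < N\<close>. The guard \<open>n > 0\<close> stands inside the existential so that
      \<open>K\<close> is total and nonnegative, also at 0.\<close>
    have "\<forall>n. \<exists>K\<ge>0. n > 0 \<longrightarrow>
      (\<forall>\<epsilon>>0. real (mixing_time (X n) (P n) (\<pi> n) \<epsilon>) \<le> 1 + K * inverse \<epsilon>)"
    proof
      fix n
      show "\<exists>K\<ge>0. n > 0 \<longrightarrow>
        (\<forall>\<epsilon>>0. real (mixing_time (X n) (P n) (\<pi> n) \<epsilon>) \<le> 1 + K * inverse \<epsilon>)"
      proof (cases "n > 0")
        case True
        obtain \<delta> where \<delta>: "0 < \<delta>" "\<delta> \<le> 1" "\<And>t. worst_dist (X n) (P n) (\<pi> n) t \<le> (1 - \<delta>) ^ t"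
          using uniform_metropolis.decay_rate_exists[OF chains[OF True]] by blast
        show ?thesis
          using mixing_time_geometric(2)[OF \<delta>(3,1,2)] \<delta>(1) by (intro exI[of _ "1 / \<delta>"]) auto
      qed auto
    qed
    then obtain K where K0: "\<And>n. 0 \<le> K n" and
      K: "\<And>n \<epsilon>. n > 0 \<Longrightarrow> \<epsilon> > 0 \<Longrightarrow>
        real (mixing_time (X n) (P n) (\<pi> n) \<epsilon>) \<le> 1 + K n * inverse \<epsilon>"
      by metis
    define S where "S = (\<Sum>n<N. K n)"
    \<comment> \<open>\<open>S\<close> covers \<open>n < N\<close>. Beyond, the absolute value of
      \<open>h\<close> need not be polynomial, so \<open>1 + h\<^sup>2\<close> dominates it; the 3
      comes from \<open>mixing_time_le\<close>.\<close>
    define q where "q = [:S + 3 * c:] + smult (3 * c) (h * h)"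
    have q: "poly q b = S + 3 * c * (1 + (poly h b)\<^sup>2)" for b
      by (simp add: q_def power2_eq_square algebra_simps)
    have S: "0 \<le> S" unfolding S_def by (intro sum_nonneg K0)
    have "real (mixing_time (X n) (P n) (\<pi> n) \<epsilon>) \<le> poly (poly [:1, q:] [:inverse \<epsilon>:]) (real n)"
      if n: "n > 0" and \<epsilon>: "\<epsilon> > 0" for n \<epsilon>
    proof -
      have "real (mixing_time (X n) (P n) (\<pi> n) \<epsilon>) \<le> 1 + poly q (real n) * inverse \<epsilon>"
      proof (cases "n < N")
        case True
        have "K n \<le> S"
          unfolding S_def using True by (intro member_le_sum K0) auto
        also have "\<dots> \<le> poly q (real n)" using c by (simp add: q)
        finally have "K n * inverse \<epsilon> \<le> poly q (real n) * inverse \<epsilon>"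
          using \<epsilon> by (intro mult_right_mono) auto
        then show ?thesis using K[OF n \<epsilon>] by linarith
      next
        case False
        then have c3: "3 \<le> card (X n)" and "\<bar>f n\<bar> \<le> c * \<bar>poly h (real n)\<bar>"
          using N0 N1 by (auto simp: N_def)
        moreover have "\<bar>b\<bar> \<le> 1 + b\<^sup>2" for b :: real
          using zero_le_power2[of "\<bar>b\<bar> - 1"] by (simp add: power2_eq_square algebra_simps)
        then have "c * \<bar>poly h (real n)\<bar> \<le> c * (1 + (poly h (real n))\<^sup>2)"
          using c by (intro mult_left_mono) auto
        ultimately have "3 * f n \<le> poly q (real n)"
          using S abs_ge_self[of "f n"] by (simp add: q)
        then have "3 * f n * inverse \<epsilon> \<le> poly q (real n) * inverse \<epsilon>"
          using \<epsilon> by (intro mult_right_mono) auto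
        moreover have "real (mixing_time (X n) (P n) (\<pi> n) \<epsilon>) \<le> 1 + 3 * f n * inverse \<epsilon>"
          using uniform_metropolis.mixing_time_le[OF chains[OF n] c3 \<epsilon>] by (simp add: f_def m_def[OF n])
        ultimately show ?thesis by linarith
      qed
      then show ?thesis by (simp add: algebra_simps)
    qed
    then show "rapidly_mixing X P \<pi>"
      unfolding rapidly_mixing_def by blast
  }
qed

end
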